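(* Let $G$ be an $r$-regular, connected, bipartite graph with $r\geq 2$, having $n$ vertices and $m$ edges, with bipartition $V(G)=V_1\cup V_2$. Let $R_G$ be its $n\times m$ vertex-edge incidence matrix. Let $2r=q_0>q_1>\cdots>q_d=0$ be all the distinct signless Laplacian eigenvalues of $G$ with multiplicities $l_0,\dots,l_d$, and let $x_1^{(i)},\dots,x_{l_i}^{(i)}$ be orthonormal eigenvectors of $Q_G$ for $q_i$. Let $y_1,\dots,y_{m-n+1}$ be orthonormal vectors in $\mathbb{R}^m$ with $R_Gy_k=0$. Then $2r-2$, $r$ and $$q_{i\pm}=\frac{3r+q_i-2\pm\sqrt{(q_i+r-2)^2+4q_i}}{2}$$ are signless Laplacian eigenvalues of $\mathcal{Q}(G)$, with corresponding eigenvectors $$Y_k=\frac{1}{\|y_k\|}\begin{pmatrix}0\\ y_k\end{pmatrix}\ (k=1,\dots,m-n+1),\qquad \frac{1}{\sqrt n}\begin{pmatrix}j_{|V_1|}\\ -j_{|V_2|}\\ 0_m\end{pmatrix},$$ and $$X_{i\pm}^{j}=\frac{1}{\sqrt{(q_{i\pm}+2-2r-q_i)^2+q_i}}\begin{pmatrix}(q_{i\pm}+2-2r-q_i)x_j^{(i)}\\ R_G^Tx_j^{(i)}\end{pmatrix}$$ for $j=1,\dots,l_i$, $i=0,1,\dots,d-1$, respectively.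
   Context: For a graph $H$, the signless Laplacian matrix is $Q_H=D(H)+A(H)$ (diagonal degree matrix plus adjacency matrix); its eigenvalues are the signless Laplacian eigenvalues of $H$. The vertex-edge incidence matrix $R_G$ has $(i,j)$ entry $1$ if vertex $v_i$ is incident to edge $e_j$ and $0$ otherwise. The $\mathcal{Q}$-graph $\mathcal{Q}(G)$ is obtained from $G$ by inserting a new vertex into each edge of $G$ (the new vertex on $e_j$ is adjacent to both endpoints of $e_j$, the original edge being replaced) and joining two new vertices by an edge whenever the corresponding edges of $G$ share an endpoint. Vertices of $\mathcal{Q}(G)$ are ordered as the vertices of $G$ (those of $V_1$ first, then those of $V_2$) followed by the $m$ new vertices in the order of the edges; $j_k$ is the all-ones vector of length $k$ and $0_m$ the zero vector of length $m$. *)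

theory Defs
  imports Complex_Main "Jordan_Normal_Form.Char_Poly"
begin

(* A graph is a pair of a vertex set and a set of two-element edges. *)
type_synonym 'a ugraph = "'a set \<times> 'a set set"

abbreviation verts :: "'a ugraph \<Rightarrow> 'a set" where "verts \<equiv> fst"
abbreviation edges :: "'a ugraph \<Rightarrow> 'a set set" where "edges \<equiv> snd"

definition finite_simple_graph :: "'a ugraph \<Rightarrow> bool" where
  "finite_simple_graph G \<longleftrightarrow>
     finite (verts G) \<and> (\<forall>e\<in>edges G. e \<subseteq> verts G \<and> card e = 2)"

definition adjacent :: "'a ugraph \<Rightarrow> 'a \<Rightarrow> 'a \<Rightarrow> bool" where
  "adjacent G u v \<longleftrightarrow> {u, v} \<in> edges G"

definition vdegree :: "'a ugraph \<Rightarrow> 'a \<Rightarrow> nat" where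
  "vdegree G v = card {e \<in> edges G. v \<in> e}"

definition regular_graph :: "nat \<Rightarrow> 'a ugraph \<Rightarrow> bool" where
  "regular_graph r G \<longleftrightarrow> (\<forall>v\<in>verts G. vdegree G v = r)"

definition connected_graph :: "'a ugraph \<Rightarrow> bool" where
  "connected_graph G \<longleftrightarrow>
     verts G \<noteq> {} \<and> (\<forall>u\<in>verts G. \<forall>v\<in>verts G. (adjacent G)\<^sup>*\<^sup>* u v)"

definition bipartition :: "'a ugraph \<Rightarrow> 'a set \<Rightarrow> 'a set \<Rightarrow> bool" where
  "bipartition G V\<^sub>1 V\<^sub>2 \<longleftrightarrow>
     verts G = V\<^sub>1 \<union> V\<^sub>2 \<and> V\<^sub>1 \<inter> V\<^sub>2 = {} \<and>
     (\<forall>e\<in>edges G. \<exists>u\<in>V\<^sub>1. \<exists>v\<in>V\<^sub>2. e = {u, v})"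

(* Rows and columns of the matrices below are indexed through such an enumeration. *)
definition enumerates :: "'b list \<Rightarrow> 'b set \<Rightarrow> bool" where
  "enumerates xs S \<longleftrightarrow> distinct xs \<and> set xs = S"

definition adjacency_matrix :: "'a ugraph \<Rightarrow> 'a list \<Rightarrow> real mat" where
  "adjacency_matrix G vs = mat (length vs) (length vs)
     (\<lambda>(i, j). if adjacent G (vs ! i) (vs ! j) then 1 else 0)"

definition degree_matrix :: "'a ugraph \<Rightarrow> 'a list \<Rightarrow> real mat" where
  "degree_matrix G vs = mat (length vs) (length vs)
     (\<lambda>(i, j). if i = j then real (vdegree G (vs ! i)) else 0)"

definition signless_laplacian :: "'a ugraph \<Rightarrow> 'a list \<Rightarrow> real mat" where
  "signless_laplacian G vs = degree_matrix G vs + adjacency_matrix G vs"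

definition incidence_matrix :: "'a list \<Rightarrow> 'a set list \<Rightarrow> real mat" where
  "incidence_matrix vs es = mat (length vs) (length es)
     (\<lambda>(i, j). if vs ! i \<in> es ! j then 1 else 0)"

(* The vertex inserted into the edge e is Inr e; the old vertex v is Inl v. *)
definition Q_graph :: "'a ugraph \<Rightarrow> ('a + 'a set) ugraph" where
  "Q_graph G =
     (Inl ` verts G \<union> Inr ` edges G,
      {{Inl v, Inr e} | v e. e \<in> edges G \<and> v \<in> e} \<union>
      {{Inr e, Inr f} | e f. e \<in> edges G \<and> f \<in> edges G \<and> e \<noteq> f \<and> e \<inter> f \<noteq> {}})"

definition Q_graph_order :: "'a list \<Rightarrow> 'a set list \<Rightarrow> ('a + 'a set) list" where
  "Q_graph_order vs es = map Inl vs @ map Inr es"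

definition euclidean_norm :: "real vec \<Rightarrow> real" where
  "euclidean_norm v = sqrt (v \<bullet> v)"

definition orthonormal_family :: "nat \<Rightarrow> 'i set \<Rightarrow> ('i \<Rightarrow> real vec) \<Rightarrow> bool" where
  "orthonormal_family N I f \<longleftrightarrow>
     (\<forall>i\<in>I. f i \<in> carrier_vec N) \<and>
     (\<forall>i\<in>I. \<forall>j\<in>I. f i \<bullet> f j = (if i = j then 1 else 0))"

end

theory Submission
  imports Defs
begin

text \<open>For an \<open>r\<close>-regular graph with incidence matrix \<open>R\<close> one has \<open>R R\<^sup>T = Q\<^sub>G\<close>, and the signless
  Laplacian of the \<open>\<Q>\<close>-graph is the block matrix with rows \<open>(r I, R)\<close> and
  \<open>(R\<^sup>T, (2r-2) I + R\<^sup>T R)\<close>. Vectors \<open>(0, y)\<close> with \<open>R y = 0\<close> and \<open>(z, 0)\<close> with \<open>R\<^sup>T z = 0\<close> are then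
  eigenvectors for \<open>2r-2\<close> and \<open>r\<close>, and for \<open>Q\<^sub>G x = q x\<close> the vector \<open>(c x, R\<^sup>T x)\<close> with
  \<open>c = \<theta> + 2 - 2r - q\<close> is one for \<open>\<theta>\<close> as soon as \<open>c (\<theta> - r) = q\<close>; this quadratic equation has
  the roots \<open>q\<^sub>\<plusminus>\<close>.\<close>

subsection \<open>Eigenvectors of the block matrix\<close>

text \<open>Lets each eigenvector be found without its normalising factor, which is put in
  afterwards.\<close>

lemma eigenvector_smult:
  fixes A :: "'a :: field mat"
  assumes A: "A \<in> carrier_mat N N" and v: "eigenvector A v k" and a: "a \<noteq> 0"
  shows "eigenvector A (a \<cdot>\<^sub>v v) k"
proof -
  have c: "v \<in> carrier_vec N" and nz: "v \<noteq> 0\<^sub>v N" and e: "A *\<^sub>v v = k \<cdot>\<^sub>v v"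
    using v A by (auto simp: eigenvector_def)
  have "a \<cdot>\<^sub>v v \<noteq> 0\<^sub>v N"
  proof
    assume h: "a \<cdot>\<^sub>v v = 0\<^sub>v N"
    have "v = 0\<^sub>v N"
    proof (rule eq_vecI)
      fix i assume "i < dim_vec (0\<^sub>v N :: 'a vec)"
      then show "v $ i = 0\<^sub>v N $ i"
        using arg_cong[OF h, of "\<lambda>w. w $ i"] c a by auto
    qed (use c in auto)
    then show False using nz by simp
  qed
  moreover have "A *\<^sub>v (a \<cdot>\<^sub>v v) = k \<cdot>\<^sub>v (a \<cdot>\<^sub>v v)"
    using mult_mat_vec[OF A c] e by (simp add: smult_smult_assoc mult.commute)
  ultimately show ?thesis using A c by (auto simp: eigenvector_def)
qed

text \<open>The lower right block is 2r I, the degrees of the inserted vertices, plus R^T R - 2 I,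
  the adjacency matrix of the line graph. Taking arbitrary \<open>r\<close> and \<open>R\<close>
  keeps the eigenvector computations free of graphs.\<close>

definition Q_block :: "real \<Rightarrow> real mat \<Rightarrow> real mat" where
  "Q_block r R = four_block_mat (r \<cdot>\<^sub>m 1\<^sub>m (dim_row R)) R (transpose_mat R)
     ((2 * r - 2) \<cdot>\<^sub>m 1\<^sub>m (dim_col R) + transpose_mat R * R)"

lemma Q_block_carrier:
  "R \<in> carrier_mat n m \<Longrightarrow> Q_block r R \<in> carrier_mat (n + m) (n + m)"
  by (auto simp: Q_block_def)

lemma smult_one_mat_mult_vec:
  fixes v :: "'a :: comm_ring_1 vec"
  assumes "v \<in> carrier_vec n"
  shows "(k \<cdot>\<^sub>m 1\<^sub>m n) *\<^sub>v v = k \<cdot>\<^sub>v v"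
  using assms by (intro eq_vecI) (auto simp: smult_scalar_prod_distrib[of _ n])

lemma mult_mat_zero_vec:
  fixes A :: "'a :: semiring_0 mat"
  assumes "A \<in> carrier_mat n m"
  shows "A *\<^sub>v 0\<^sub>v m = 0\<^sub>v n"
  using assms by (intro eq_vecI) auto

text \<open>The product R^T R b is kept as R^T (R b), so that R y = 0 or R (R^T x) = q x can be
  substituted directly.\<close>

lemma Q_block_mult_vec:
  assumes R: "R \<in> carrier_mat n m" and a: "a \<in> carrier_vec n" and b: "b \<in> carrier_vec m"
  shows "Q_block r R *\<^sub>v (a @\<^sub>v b) =
    (r \<cdot>\<^sub>v a + R *\<^sub>v b) @\<^sub>v
    (transpose_mat R *\<^sub>v a + ((2 * r - 2) \<cdot>\<^sub>v b + transpose_mat R *\<^sub>v (R *\<^sub>v b)))"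
proof -
  have dims: "dim_row R = n" "dim_col R = m" and Rt: "transpose_mat R \<in> carrier_mat m n"
    using R by auto
  have RtR: "transpose_mat R * R \<in> carrier_mat m m" using R by auto
  have "Q_block r R *\<^sub>v (a @\<^sub>v b) = ((r \<cdot>\<^sub>m 1\<^sub>m n) *\<^sub>v a + R *\<^sub>v b) @\<^sub>v
      (transpose_mat R *\<^sub>v a + ((2 * r - 2) \<cdot>\<^sub>m 1\<^sub>m m + transpose_mat R * R) *\<^sub>v b)"
    unfolding Q_block_def dims
    by (rule four_block_mat_mult_vec[of _ n n _ m _ m]) (use R a b RtR in auto)
  also have "((2 * r - 2) \<cdot>\<^sub>m 1\<^sub>m m + transpose_mat R * R) *\<^sub>v b =
      (2 * r - 2) \<cdot>\<^sub>v b + transpose_mat R *\<^sub>v (R *\<^sub>v b)"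
    by (subst add_mult_distrib_mat_vec[OF _ RtR b])
       (use smult_one_mat_mult_vec[OF b] assoc_mult_mat_vec[OF Rt R b] in auto)
  finally show ?thesis using smult_one_mat_mult_vec[OF a] by simp
qed

lemma append_vec_eq_zero_iff:
  assumes "a \<in> carrier_vec n" "b \<in> carrier_vec m"
  shows "a @\<^sub>v b = 0\<^sub>v (n + m) \<longleftrightarrow> a = 0\<^sub>v n \<and> b = 0\<^sub>v m"
proof -
  have "(0\<^sub>v (n + m) :: 'a vec) = 0\<^sub>v n @\<^sub>v 0\<^sub>v m" by (intro eq_vecI) auto
  then show ?thesis using append_vec_eq[OF assms(1) zero_carrier_vec] by simp
qed

lemma eigenvector_Q_block_kernel:
  assumes R: "R \<in> carrier_mat n m" and y: "y \<in> carrier_vec m" "y \<noteq> 0\<^sub>v m" "R *\<^sub>v y = 0\<^sub>v n"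
  shows "eigenvector (Q_block r R) (0\<^sub>v n @\<^sub>v y) (2 * r - 2)"
proof -
  have "Q_block r R *\<^sub>v (0\<^sub>v n @\<^sub>v y) = (2 * r - 2) \<cdot>\<^sub>v (0\<^sub>v n @\<^sub>v y)"
    unfolding Q_block_mult_vec[OF R zero_carrier_vec y(1)] y(3)
    using R y(1) by (intro eq_vecI) auto
  then show ?thesis
    using Q_block_carrier[OF R, of r] y append_vec_eq_zero_iff[OF zero_carrier_vec y(1), of n]
    by (auto simp: eigenvector_def)
qed

lemma eigenvector_Q_block_cokernel:
  assumes R: "R \<in> carrier_mat n m"
    and z: "z \<in> carrier_vec n" "z \<noteq> 0\<^sub>v n" "transpose_mat R *\<^sub>v z = 0\<^sub>v m"
  shows "eigenvector (Q_block r R) (z @\<^sub>v 0\<^sub>v m) r"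
proof -
  have "Q_block r R *\<^sub>v (z @\<^sub>v 0\<^sub>v m) = r \<cdot>\<^sub>v (z @\<^sub>v 0\<^sub>v m)"
    unfolding Q_block_mult_vec[OF R z(1) zero_carrier_vec] z(3) mult_mat_zero_vec[OF R]
    using R z(1) by (intro eq_vecI) auto
  then show ?thesis
    using Q_block_carrier[OF R, of r] z append_vec_eq_zero_iff[OF z(1) zero_carrier_vec, of m]
    by (auto simp: eigenvector_def)
qed

text \<open>With w = R^T x one has R w = q x, so the span of (x, 0) and (0, w) is invariant. On (c
  x, w) the eigenvalue equation becomes c r + q = \<theta> c in the upper part and c + (2r - 2) + q
  = \<theta> in the lower part, which are the two conditions on \<open>c\<close>.\<close>

lemma eigenvector_Q_block_lift:
  assumes R: "R \<in> carrier_mat n m"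
    and x: "eigenvector (R * transpose_mat R) x q" and q: "q \<noteq> 0"
    and c: "c = \<theta> + 2 - 2 * r - q" "c * (\<theta> - r) = q"
  shows "eigenvector (Q_block r R) (c \<cdot>\<^sub>v x @\<^sub>v (transpose_mat R *\<^sub>v x)) \<theta>"
proof -
  let ?w = "transpose_mat R *\<^sub>v x"
  have Rt: "transpose_mat R \<in> carrier_mat m n" using R by auto
  have xc: "x \<in> carrier_vec n" and xnz: "x \<noteq> 0\<^sub>v n"
    and e: "R * transpose_mat R *\<^sub>v x = q \<cdot>\<^sub>v x"
    using x R by (auto simp: eigenvector_def)
  have wc: "?w \<in> carrier_vec m" using Rt xc by auto
  have Rw: "R *\<^sub>v ?w = q \<cdot>\<^sub>v x" using assoc_mult_mat_vec[OF R Rt xc] e by simp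
  \<comment> \<open>Here \<open>q \<noteq> 0\<close> enters: w = 0 would give q x = R w = 0. A
    nonzero lower part makes the whole vector nonzero.\<close>
  have wnz: "?w \<noteq> 0\<^sub>v m"
  proof
    assume "?w = 0\<^sub>v m"
    then have h: "q \<cdot>\<^sub>v x = 0\<^sub>v n" using Rw mult_mat_zero_vec[OF R] by simp
    have "x = 0\<^sub>v n"
    proof (rule eq_vecI)
      fix i assume "i < dim_vec (0\<^sub>v n :: real vec)"
      then show "x $ i = 0\<^sub>v n $ i"
        using arg_cong[OF h, of "\<lambda>w. w $ i"] xc q by auto
    qed (use xc in auto)
    then show False using xnz by simp
  qed
  have cx: "c \<cdot>\<^sub>v x \<in> carrier_vec n" using xc by auto
  have k1: "c * r + q = \<theta> * c" using c(2) by (simp add: algebra_simps)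
  have k2: "c + (2 * r - 2) + q = \<theta>" using c(1) by simp
  have "Q_block r R *\<^sub>v (c \<cdot>\<^sub>v x @\<^sub>v ?w) = (r \<cdot>\<^sub>v (c \<cdot>\<^sub>v x) + q \<cdot>\<^sub>v x) @\<^sub>v
     (c \<cdot>\<^sub>v ?w + ((2 * r - 2) \<cdot>\<^sub>v ?w + q \<cdot>\<^sub>v ?w))"
    unfolding Q_block_mult_vec[OF R cx wc] Rw mult_mat_vec[OF Rt xc] ..
  also have "r \<cdot>\<^sub>v (c \<cdot>\<^sub>v x) + q \<cdot>\<^sub>v x = \<theta> \<cdot>\<^sub>v (c \<cdot>\<^sub>v x)"
    using xc k1 by (simp add: smult_smult_assoc add_smult_distrib_vec[symmetric] mult.commute)
  also have "c \<cdot>\<^sub>v ?w + ((2 * r - 2) \<cdot>\<^sub>v ?w + q \<cdot>\<^sub>v ?w) = \<theta> \<cdot>\<^sub>v ?w"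
    using wc unfolding k2[symmetric] by (simp add: add_smult_distrib_vec assoc_add_vec[of _ m])
  also have "(\<theta> \<cdot>\<^sub>v (c \<cdot>\<^sub>v x)) @\<^sub>v (\<theta> \<cdot>\<^sub>v ?w) = \<theta> \<cdot>\<^sub>v (c \<cdot>\<^sub>v x @\<^sub>v ?w)"
    by (intro eq_vecI) auto
  finally show ?thesis
    using Q_block_carrier[OF R, of r] cx wc wnz append_vec_eq_zero_iff[OF cx wc]
    by (auto simp: eigenvector_def)
qed

subsection \<open>Incidence matrix and signless Laplacians\<close>

text \<open>Turns entries of products of 0/1 matrices into cardinalities; distinctness makes indices
  correspond to elements one to one.\<close>

lemma card_eq_sum_nth:
  assumes "distinct xs"
  shows "(\<Sum>i = 0..<length xs. if P (xs ! i) then 1 else 0 :: real) = real (card {x \<in> set xs. P x})"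
proof -
  have "(\<Sum>i = 0..<length xs. if P (xs ! i) then 1 else 0 :: real) =
      (\<Sum>x\<in>set xs. if P x then 1 else 0)"
    by (rule sum.reindex_bij_betw[OF bij_betw_nth[OF assms _ refl]]) auto
  also have "\<dots> = real (card {x \<in> set xs. P x})"
    by (simp add: sum.If_cases Int_def)
  finally show ?thesis .
qed

lemma incidence_mult_transpose_nth:
  assumes "distinct es" "i < length vs" "j < length vs"
  shows "(incidence_matrix vs es * transpose_mat (incidence_matrix vs es)) $$ (i, j) =
    real (card {e \<in> set es. vs ! i \<in> e \<and> vs ! j \<in> e})"
proof -
  have "(incidence_matrix vs es * transpose_mat (incidence_matrix vs es)) $$ (i, j) =
    (\<Sum>k = 0..<length es. if vs ! i \<in> es ! k \<and> vs ! j \<in> es ! k then 1 else 0)"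
    using assms(2,3)
    by (auto simp: incidence_matrix_def scalar_prod_def intro!: sum.cong)
  then show ?thesis
    using card_eq_sum_nth[OF assms(1), of "\<lambda>e. vs ! i \<in> e \<and> vs ! j \<in> e"] by simp
qed

lemma transpose_incidence_mult_nth:
  assumes "distinct vs" "i < length es" "j < length es"
  shows "(transpose_mat (incidence_matrix vs es) * incidence_matrix vs es) $$ (i, j) =
    real (card (set vs \<inter> (es ! i \<inter> es ! j)))"
proof -
  have "(transpose_mat (incidence_matrix vs es) * incidence_matrix vs es) $$ (i, j) =
    (\<Sum>k = 0..<length vs. if vs ! k \<in> es ! i \<inter> es ! j then 1 else 0)"
    using assms(2,3)
    by (auto simp: incidence_matrix_def scalar_prod_def intro!: sum.cong)
  then show ?thesis
    using card_eq_sum_nth[OF assms(1), of "\<lambda>v. v \<in> es ! i \<inter> es ! j"]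
    by (simp add: Int_def)
qed

lemma finite_edges: "finite_simple_graph G \<Longrightarrow> finite (edges G)"
  unfolding finite_simple_graph_def by (meson finite_Pow_iff finite_subset PowI subsetI)

lemma edge_eqI:
  assumes "finite_simple_graph G" "e \<in> edges G" "u \<in> e" "v \<in> e" "u \<noteq> v"
  shows "e = {u, v}"
proof -
  have "card e = 2" using assms(1,2) by (auto simp: finite_simple_graph_def)
  then show ?thesis using assms(3-5) by (auto simp: card_2_iff)
qed

lemma edge_has_ends:
  assumes "finite_simple_graph G" "e \<in> edges G"
  obtains u v where "e = {u, v}" "u \<noteq> v" "u \<in> verts G" "v \<in> verts G"
  using assms by (auto simp: finite_simple_graph_def card_2_iff)

text \<open>Entry (i, j) counts the edges containing both vertices: the degree on the diagonal, and
  off it at most one, since two distinct vertices determine the edge.\<close>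

lemma incidence_mult_transpose:
  assumes G: "finite_simple_graph G" and vs: "enumerates vs (verts G)"
    and es: "enumerates es (edges G)"
  shows "incidence_matrix vs es * transpose_mat (incidence_matrix vs es) = signless_laplacian G vs"
proof (rule eq_matI)
  fix i j
  assume "i < dim_row (signless_laplacian G vs)" "j < dim_col (signless_laplacian G vs)"
  then have i: "i < length vs" and j: "j < length vs"
    by (auto simp: signless_laplacian_def adjacency_matrix_def)
  have d: "distinct es" "set es = edges G" "distinct vs"
    using es vs by (auto simp: enumerates_def)
  have "real (card {e \<in> edges G. vs ! i \<in> e \<and> vs ! j \<in> e}) = signless_laplacian G vs $$ (i, j)"
  proof (cases "i = j")
    case True
    \<comment> \<open>A loop would be the singleton \<open>{v, v}\<close>, which does not have two
      elements.\<close>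
    have "\<not> adjacent G (vs ! j) (vs ! j)"
      using G by (fastforce simp: adjacent_def finite_simple_graph_def)
    then show ?thesis using True j
      by (simp add: signless_laplacian_def adjacency_matrix_def degree_matrix_def vdegree_def)
  next
    case False
    then have ne: "vs ! i \<noteq> vs ! j" using d(3) i j by (simp add: nth_eq_iff_index_eq)
    have "{e \<in> edges G. vs ! i \<in> e \<and> vs ! j \<in> e} =
        {e \<in> edges G. e = {vs ! i, vs ! j}}"
      using edge_eqI[OF G _ _ _ ne] by blast
    also have "\<dots> = (if adjacent G (vs ! i) (vs ! j) then {{vs ! i, vs ! j}} else {})"
      by (auto simp: adjacent_def)
    finally have "{e \<in> edges G. vs ! i \<in> e \<and> vs ! j \<in> e} =
        (if adjacent G (vs ! i) (vs ! j) then {{vs ! i, vs ! j}} else {})" .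
    then show ?thesis using False i j ne
      by (simp add: signless_laplacian_def adjacency_matrix_def degree_matrix_def)
  qed
  then show "(incidence_matrix vs es * transpose_mat (incidence_matrix vs es)) $$ (i, j) =
      signless_laplacian G vs $$ (i, j)"
    using incidence_mult_transpose_nth[OF d(1) i j] d(2) by simp
qed (auto simp: signless_laplacian_def adjacency_matrix_def incidence_matrix_def)

section \<open>Degrees and signless Laplacian of the \<open>Q_graph\<close>\<close>

lemma vdegree_eq_card_neighbours:
  assumes "\<And>e. e \<in> edges H \<Longrightarrow> card e = 2"
  shows "vdegree H v = card {u. adjacent H v u}"
proof -
  \<comment> \<open>An edge at v corresponds to its other end. In the \<open>Q_graph\<close>
    neighbours are easier to list than edges.\<close>
  have "bij_betw (\<lambda>u. {v, u}) {u. adjacent H v u} {e \<in> edges H. v \<in> e}"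
    unfolding bij_betw_def
  proof
    show "inj_on (\<lambda>u. {v, u}) {u. adjacent H v u}"
      by (auto simp: inj_on_def doubleton_eq_iff)
    show "(\<lambda>u. {v, u}) ` {u. adjacent H v u} = {e \<in> edges H. v \<in> e}"
    proof (intro equalityI subsetI)
      fix e assume e: "e \<in> {e \<in> edges H. v \<in> e}"
      then obtain a b where "e = {a, b}" using assms[of e] by (auto simp: card_2_iff)
      then have "e = {v, if v = a then b else a}" using e by auto
      then show "e \<in> (\<lambda>u. {v, u}) ` {u. adjacent H v u}" using e by (auto simp: adjacent_def)
    qed (auto simp: adjacent_def)
  qed
  then show ?thesis unfolding vdegree_def by (rule bij_betw_same_card[symmetric])
qed

lemma adjacent_Q_graph:
  "\<not> adjacent (Q_graph G) (Inl u) (Inl v)"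
  "adjacent (Q_graph G) (Inl v) (Inr e) \<longleftrightarrow> e \<in> edges G \<and> v \<in> e"
  "adjacent (Q_graph G) (Inr e) (Inl v) \<longleftrightarrow> e \<in> edges G \<and> v \<in> e"
  "adjacent (Q_graph G) (Inr e) (Inr f) \<longleftrightarrow>
     e \<in> edges G \<and> f \<in> edges G \<and> e \<noteq> f \<and> e \<inter> f \<noteq> {}"
  by (auto simp: adjacent_def Q_graph_def doubleton_eq_iff)

lemma card_Q_graph_edge: "e \<in> edges (Q_graph G) \<Longrightarrow> card e = 2"
  by (auto simp: Q_graph_def card_2_iff)

lemma vdegree_Q_graph_Inl: "vdegree (Q_graph G) (Inl v) = vdegree G v"
proof -
  have "{u. adjacent (Q_graph G) (Inl v) u} = Inr ` {e \<in> edges G. v \<in> e}"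
  proof (rule Set.set_eqI)
    fix u show "u \<in> {u. adjacent (Q_graph G) (Inl v) u} \<longleftrightarrow> u \<in> Inr ` {e \<in> edges G. v \<in> e}"
      by (cases u) (auto simp: adjacent_Q_graph)
  qed
  then show ?thesis
    using vdegree_eq_card_neighbours[of "Q_graph G" "Inl v"] card_Q_graph_edge[of _ G]
    by (simp add: card_image vdegree_def)
qed

text \<open>For e = {a, b} the neighbours of \<open>Inr e\<close> are the two ends and the other
  edges through a or b. Only e passes through both, so the latter number (2r - 1) - 1, and the total
  is 2r.\<close>

lemma vdegree_Q_graph_Inr:
  assumes G: "finite_simple_graph G" and r: "regular_graph r G" and e: "e \<in> edges G"
  shows "vdegree (Q_graph G) (Inr e) = 2 * r"
proof -
  obtain a b where ab: "e = {a, b}" "a \<noteq> b" "a \<in> verts G" "b \<in> verts G"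
    using edge_has_ends[OF G e] .
  define S where "S v = {f \<in> edges G. v \<in> f}" for v
  have fin: "finite (S v)" for v using finite_edges[OF G] by (simp add: S_def)
  have cS: "card (S a) = r" "card (S b) = r"
    using r ab by (auto simp: regular_graph_def vdegree_def S_def)
  have int: "S a \<inter> S b = {e}" using edge_eqI[OF G _ _ _ ab(2)] e unfolding S_def ab(1) by blast
  have nb: "{u. adjacent (Q_graph G) (Inr e) u} = Inl ` {a, b} \<union> Inr ` (S a \<union> S b - {e})"
  proof (rule Set.set_eqI)
    fix u
    show "u \<in> {u. adjacent (Q_graph G) (Inr e) u} \<longleftrightarrow>
        u \<in> Inl ` {a, b} \<union> Inr ` (S a \<union> S b - {e})"
      using e by (cases u) (auto simp: adjacent_Q_graph S_def ab(1))
  qed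
  have "card {u. adjacent (Q_graph G) (Inr e) u} = 2 + card (S a \<union> S b - {e})"
    unfolding nb using fin ab(2)
    by (subst card_Un_disjoint) (auto simp: card_image)
  also have "card (S a \<union> S b - {e}) = card (S a \<union> S b) - 1"
    using int by (subst card_Diff_singleton) auto
  also have "2 + (card (S a \<union> S b) - 1) = 2 * r"
  proof -
    have s: "card (S a \<union> S b) + 1 = 2 * r"
      using card_Un_Int[OF fin fin, of a b] int cS by simp
    \<comment> \<open>Ensures that the natural number subtraction of 1 is not truncated.\<close>
    have "card (S a \<union> S b) \<ge> 1"
      using int fin by (metis One_nat_def Suc_leI UnCI Int_iff card_gt_0_iff empty_iff finite_UnI insertI1)
    then show ?thesis using s by linarith
  qed
  finally show ?thesis
    using vdegree_eq_card_neighbours[of "Q_graph G" "Inr e"] card_Q_graph_edge[of _ G] by simp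
qed

text \<open>Distinct edges share at most one vertex, since two common vertices would determine both
  edges. Hence R^T R - 2 I is the adjacency matrix of the line graph.\<close>

lemma transpose_incidence_mult:
  assumes G: "finite_simple_graph G" and vs: "enumerates vs (verts G)"
    and es: "enumerates es (edges G)" and i: "i < length es" and j: "j < length es"
  shows "(transpose_mat (incidence_matrix vs es) * incidence_matrix vs es) $$ (i, j) =
    (if i = j then 2 else if es ! i \<inter> es ! j \<noteq> {} then 1 else 0)"
proof -
  have d: "distinct es" "set es = edges G" "distinct vs" "set vs = verts G"
    using es vs by (auto simp: enumerates_def)
  have ei: "es ! i \<in> edges G" and ej: "es ! j \<in> edges G" using i j d by auto
  have sub: "set vs \<inter> (es ! i \<inter> es ! j) = es ! i \<inter> es ! j"
    using G ei d(4) by (auto simp: finite_simple_graph_def)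
  have c2: "card (es ! i) = 2" using G ei by (auto simp: finite_simple_graph_def)
  have "real (card (es ! i \<inter> es ! j)) =
      (if i = j then 2 else if es ! i \<inter> es ! j \<noteq> {} then 1 else 0)"
  proof (cases "i = j \<or> es ! i \<inter> es ! j = {}")
    case True then show ?thesis using c2 by auto
  next
    case False
    then obtain v where v: "v \<in> es ! i" "v \<in> es ! j" by auto
    have ne: "es ! i \<noteq> es ! j" using False d(1) i j by (simp add: nth_eq_iff_index_eq)
    have "es ! i \<inter> es ! j = {v}"
      using edge_eqI[OF G ei v(1)] edge_eqI[OF G ej v(2)] ne v by auto
    then show ?thesis using False by auto
  qed
  then show ?thesis using transpose_incidence_mult_nth[OF d(3) i j] sub by simp
qed

lemma signless_laplacian_Q_graph:
  assumes G: "finite_simple_graph G" and r: "regular_graph r G"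
    and vs: "enumerates vs (verts G)" and es: "enumerates es (edges G)"
  shows "signless_laplacian (Q_graph G) (Q_graph_order vs es) =
    Q_block (real r) (incidence_matrix vs es)"
    (is "?L = Q_block _ ?R")
proof (rule eq_matI)
  let ?n = "length vs" and ?m = "length es"
  have R: "?R \<in> carrier_mat ?n ?m" by (simp add: incidence_matrix_def)
  have dims: "dim_row ?R = ?n" "dim_col ?R = ?m" using R by auto
  show "dim_row ?L = dim_row (Q_block (real r) ?R)" "dim_col ?L = dim_col (Q_block (real r) ?R)"
    using Q_block_carrier[OF R, of "real r"]
    by (auto simp: signless_laplacian_def adjacency_matrix_def Q_graph_order_def)
  have d: "distinct es" "set es = edges G" "distinct vs" "set vs = verts G"
    using es vs by (auto simp: enumerates_def)
  fix i j
  assume "i < dim_row (Q_block (real r) ?R)" "j < dim_col (Q_block (real r) ?R)"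
  then have ij: "i < ?n + ?m" "j < ?n + ?m"
    using Q_block_carrier[OF R, of "real r"] by auto
  define D where "D = (if i = j then real (vdegree (Q_graph G) (Q_graph_order vs es ! i)) else 0)"
  define A where "A = (if adjacent (Q_graph G) (Q_graph_order vs es ! i) (Q_graph_order vs es ! j)
      then 1 else 0 :: real)"
  have L: "?L $$ (i, j) = D + A"
    using ij by (simp add: signless_laplacian_def adjacency_matrix_def degree_matrix_def
        Q_graph_order_def D_def A_def)
  have ord: "Q_graph_order vs es ! k = (if k < ?n then Inl (vs ! k) else Inr (es ! (k - ?n)))"
    if "k < ?n + ?m" for k
    using that by (auto simp: Q_graph_order_def nth_append)
  have B: "Q_block (real r) ?R $$ (i, j) =
      (if i < ?n then if j < ?n then (if i = j then real r else 0) else ?R $$ (i, j - ?n)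
       else if j < ?n then ?R $$ (j, i - ?n)
       else (if i = j then 2 * real r - 2 else 0) + (transpose_mat ?R * ?R) $$ (i - ?n, j - ?n))"
    using ij R unfolding Q_block_def four_block_mat_def Let_def dims
    by (auto simp: dims)
  have E: "es ! (k - ?n) \<in> edges G" if "\<not> k < ?n" "k < ?n + ?m" for k
    using that d(2) by (metis add_diff_inverse_nat nat_add_left_cancel_less nth_mem)
  have Vr: "vdegree G (vs ! k) = r" if "k < ?n" for k
    using that r d(4) by (auto simp: regular_graph_def)
  consider "i < ?n" "j < ?n" | "i < ?n" "\<not> j < ?n" | "\<not> i < ?n" "j < ?n" | "\<not> i < ?n" "\<not> j < ?n"
    by blast
  then have "D + A = Q_block (real r) ?R $$ (i, j)"
  proof cases
    case 1
    then show ?thesis unfolding B D_def A_def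
      by (simp add: ord adjacent_Q_graph vdegree_Q_graph_Inl Vr)
  next
    case 2
    then show ?thesis unfolding B D_def A_def using ij E[of j]
      by (auto simp: ord adjacent_Q_graph incidence_matrix_def)
  next
    case 3
    then show ?thesis unfolding B D_def A_def using ij E[of i]
      by (auto simp: ord adjacent_Q_graph incidence_matrix_def)
  next
    case 4
    have lt: "i - ?n < ?m" "j - ?n < ?m" using 4 ij by auto
    \<comment> \<open>Matches the condition that adjacent inserted vertices come from different
      edges with the off-diagonal positions. On the diagonal the degree 2r equals (2r - 2) +
      2.\<close>
    have eq: "i - ?n = j - ?n \<longleftrightarrow> i = j" "es ! (i - ?n) = es ! (j - ?n) \<longleftrightarrow> i = j"
      using 4 lt d(1) by (auto simp: nth_eq_iff_index_eq)
    show ?thesis unfolding B D_def A_def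
      using 4 ij E[of i] E[of j] vdegree_Q_graph_Inr[OF G r] transpose_incidence_mult[OF G vs es lt]
      by (simp add: ord adjacent_Q_graph eq)
  qed
  then show "?L $$ (i, j) = Q_block (real r) ?R $$ (i, j)" using L by simp
qed

section \<open>Edge count and the sign vector of the bipartition\<close>

lemma handshake:
  assumes G: "finite_simple_graph G" and r: "regular_graph r G"
  shows "r * card (verts G) = 2 * card (edges G)"
proof -
  have fv: "finite (verts G)" using G by (simp add: finite_simple_graph_def)
  have "\<forall>e\<in>edges G. card {v \<in> verts G. v \<in> e} = 2"
  proof
    fix e assume "e \<in> edges G"
    then have "{v \<in> verts G. v \<in> e} = e" "card e = 2" using G by (auto simp: finite_simple_graph_def)
    then show "card {v \<in> verts G. v \<in> e} = 2" by simp
  qed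
  \<comment> \<open>Double counting of incident vertex-edge pairs.\<close>
  then have "(\<Sum>v\<in>verts G. card {e \<in> edges G. v \<in> e}) = 2 * card (edges G)"
    by (rule sum_multicount[OF fv finite_edges[OF G]])
  moreover have "(\<Sum>v\<in>verts G. card {e \<in> edges G. v \<in> e}) = r * card (verts G)"
    using r by (simp add: regular_graph_def vdegree_def)
  ultimately show ?thesis by simp
qed

text \<open>Each edge has one end in each class, so its two contributions 1 and -1 cancel.\<close>

lemma transpose_incidence_mult_vec:
  assumes vs: "enumerates vs (verts G)" and G: "finite_simple_graph G"
    and es: "enumerates es (edges G)" and V: "bipartition G V\<^sub>1 V\<^sub>2"
  shows "transpose_mat (incidence_matrix vs es) *\<^sub>v
      vec (length vs) (\<lambda>i. if vs ! i \<in> V\<^sub>1 then 1 else - 1) = 0\<^sub>v (length es)"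
proof (rule eq_vecI)
  have d: "set es = edges G" "distinct vs" "set vs = verts G"
    using es vs by (auto simp: enumerates_def)
  fix k assume "k < dim_vec (0\<^sub>v (length es) :: real vec)"
  then have k: "k < length es" by simp
  then have e: "es ! k \<in> edges G" using d by auto
  obtain u v where uv: "u \<in> V\<^sub>1" "v \<in> V\<^sub>2" "es ! k = {u, v}"
    using V e by (auto simp: bipartition_def)
  have nv: "v \<notin> V\<^sub>1" "u \<noteq> v" and uG: "u \<in> verts G" "v \<in> verts G"
    using V uv by (auto simp: bipartition_def)
  have "(transpose_mat (incidence_matrix vs es) *\<^sub>v
      vec (length vs) (\<lambda>i. if vs ! i \<in> V\<^sub>1 then 1 else - 1)) $ k =
      (\<Sum>i = 0..<length vs. if vs ! i \<in> es ! k then if vs ! i \<in> V\<^sub>1 then 1 else - 1 else 0)"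
    using k by (auto simp: incidence_matrix_def scalar_prod_def intro!: sum.cong)
  also have "\<dots> = (\<Sum>w\<in>verts G. if w \<in> es ! k then if w \<in> V\<^sub>1 then 1 else - 1 else 0)"
    by (rule sum.reindex_bij_betw[OF bij_betw_nth[OF d(2)]]) (use d in auto)
  also have "\<dots> = (\<Sum>w\<in>{u, v}. if w \<in> V\<^sub>1 then 1 else - 1)"
    using uG G unfolding uv(3)
    by (intro sum.mono_neutral_cong_right) (auto simp: finite_simple_graph_def)
  also have "\<dots> = 0" using uv nv by simp
  finally show "(transpose_mat (incidence_matrix vs es) *\<^sub>v
      vec (length vs) (\<lambda>i. if vs ! i \<in> V\<^sub>1 then 1 else - 1)) $ k = 0\<^sub>v (length es) $ k"
    using k by simp
qed (simp add: incidence_matrix_def)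

section \<open>Eigenpairs of the signless Laplacian of the \<open>Q_graph\<close>\<close>

theorem theorem3p2:
  fixes G :: "'a ugraph" and V\<^sub>1 V\<^sub>2 :: "'a set"
    and vs\<^sub>1 vs\<^sub>2 vs :: "'a list" and es :: "'a set list"
    and r n m d :: nat
    and q :: "nat \<Rightarrow> real" and l :: "nat \<Rightarrow> nat"
    and x :: "nat \<Rightarrow> nat \<Rightarrow> real vec" and y :: "nat \<Rightarrow> real vec"
    and R Q\<^sub>G Q\<^sub>Q :: "real mat"
  assumes G: "finite_simple_graph G" "connected_graph G" "regular_graph r G" "r \<ge> 2"
    and n: "n = card (verts G)" and m: "m = card (edges G)"
    and V: "bipartition G V\<^sub>1 V\<^sub>2"
    and vs: "enumerates vs\<^sub>1 V\<^sub>1" "enumerates vs\<^sub>2 V\<^sub>2" "vs = vs\<^sub>1 @ vs\<^sub>2"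
    and es: "enumerates es (edges G)"
    and R: "R = incidence_matrix vs es"
    and Q\<^sub>G: "Q\<^sub>G = signless_laplacian G vs"
    and Q\<^sub>Q: "Q\<^sub>Q = signless_laplacian (Q_graph G) (Q_graph_order vs es)"
    and q: "q 0 = 2 * real r" "q d = 0"
      "\<And>i j. i < j \<Longrightarrow> j \<le> d \<Longrightarrow> q i > q j"
      "{\<theta>. eigenvalue Q\<^sub>G \<theta>} = q ` {0..d}"
    and l: "\<And>i. i \<le> d \<Longrightarrow> l i = order (q i) (char_poly Q\<^sub>G)"
    and x: "\<And>i. i \<le> d \<Longrightarrow> orthonormal_family n {1..l i} (x i)"
      "\<And>i j. i \<le> d \<Longrightarrow> j \<in> {1..l i} \<Longrightarrow> eigenvector Q\<^sub>G (x i j) (q i)"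
    and y: "orthonormal_family m {1..m + 1 - n} y"
      "\<And>k. k \<in> {1..m + 1 - n} \<Longrightarrow> R *\<^sub>v y k = 0\<^sub>v n"
  shows
    "eigenvalue Q\<^sub>Q (2 * real r - 2) \<and>
     (\<forall>k\<in>{1..m + 1 - n}.
        eigenvector Q\<^sub>Q ((1 / euclidean_norm (y k)) \<cdot>\<^sub>v (0\<^sub>v n @\<^sub>v y k)) (2 * real r - 2)) \<and>
     eigenvalue Q\<^sub>Q (real r) \<and>
     eigenvector Q\<^sub>Q
       ((1 / sqrt (real n)) \<cdot>\<^sub>v (vec (card V\<^sub>1) (\<lambda>_. 1) @\<^sub>v vec (card V\<^sub>2) (\<lambda>_. - 1) @\<^sub>v 0\<^sub>v m))
       (real r) \<and>
     (\<forall>i<d. \<forall>s\<in>{1, -1}.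
        let \<theta> = (3 * real r + q i - 2 + s * sqrt ((q i + real r - 2)\<^sup>2 + 4 * q i)) / 2;
            c = \<theta> + 2 - 2 * real r - q i
        in eigenvalue Q\<^sub>Q \<theta> \<and>
           (\<forall>j\<in>{1..l i}.
              eigenvector Q\<^sub>Q
                ((1 / sqrt (c\<^sup>2 + q i)) \<cdot>\<^sub>v (c \<cdot>\<^sub>v x i j @\<^sub>v (transpose_mat R *\<^sub>v x i j))) \<theta>))"
proof -
  have bip: "verts G = V\<^sub>1 \<union> V\<^sub>2" "V\<^sub>1 \<inter> V\<^sub>2 = {}" using V by (auto simp: bipartition_def)
  have ev: "enumerates vs (verts G)" using vs bip by (auto simp: enumerates_def)
  have len1: "length vs\<^sub>1 = card V\<^sub>1" and len2: "length vs\<^sub>2 = card V\<^sub>2"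
    using vs by (auto simp: enumerates_def distinct_card[symmetric])
  have len: "length vs = n" "length es = m"
    using ev es n m by (auto simp: enumerates_def distinct_card[symmetric])
  have n12: "n = card V\<^sub>1 + card V\<^sub>2" using len len1 len2 vs(3) by simp
  have Rc: "R \<in> carrier_mat n m" using R len by (simp add: incidence_matrix_def)
  have QQ: "Q\<^sub>Q = Q_block (real r) R"
    using signless_laplacian_Q_graph[OF G(1,3) ev es] Q\<^sub>Q R by simp
  have QG: "R * transpose_mat R = Q\<^sub>G"
    using incidence_mult_transpose[OF G(1) ev es] Q\<^sub>G R by simp
  have QQc: "Q\<^sub>Q \<in> carrier_mat (n + m) (n + m)" using Q_block_carrier[OF Rc] QQ by simp
  have n0: "n > 0"
    using G(1,2) n by (auto simp: connected_graph_def finite_simple_graph_def card_gt_0_iff)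
  \<comment> \<open>From 2m = rn and r \<ge> 2. This keeps \<open>m + 1 - n\<close> from being
    truncated and positive, so y 1 exists and witnesses the eigenvalue 2r - 2.\<close>
  have nm: "n \<le> m"
  proof -
    have "2 * n \<le> r * n" using G(4) by simp
    then show ?thesis using handshake[OF G(1,3)] n m by simp
  qed

  have Y: "eigenvector Q\<^sub>Q ((1 / euclidean_norm (y k)) \<cdot>\<^sub>v (0\<^sub>v n @\<^sub>v y k)) (2 * real r - 2)"
    if k: "k \<in> {1..m + 1 - n}" for k
  proof -
    have yc: "y k \<in> carrier_vec m" and yy: "y k \<bullet> y k = 1"
      using y(1) k by (auto simp: orthonormal_family_def)
    have "y k \<noteq> 0\<^sub>v m" using yy by auto
    then have "eigenvector Q\<^sub>Q (0\<^sub>v n @\<^sub>v y k) (2 * real r - 2)"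
      unfolding QQ using eigenvector_Q_block_kernel[OF Rc yc _ y(2)[OF k]] by blast
    then show ?thesis
      by (rule eigenvector_smult[OF QQc]) (simp add: euclidean_norm_def yy)
  qed
  have "1 \<in> {1..m + 1 - n}" using nm by simp
  then have Y0: "eigenvalue Q\<^sub>Q (2 * real r - 2)" using Y unfolding eigenvalue_def by blast

  let ?j = "vec (card V\<^sub>1) (\<lambda>_. 1) @\<^sub>v vec (card V\<^sub>2) (\<lambda>_. - 1) @\<^sub>v 0\<^sub>v m :: real vec"
  let ?z = "vec n (\<lambda>i. if vs ! i \<in> V\<^sub>1 then 1 else - 1) :: real vec"
  \<comment> \<open>The enumeration lists \<open>V\<^sub>1\<close> first, so the class of a vertex
    is read off its position; this identifies the stacked vector \<open>?j\<close> with the sign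
    vector \<open>?z\<close> padded by zeros.\<close>
  have mem: "vs ! i \<in> V\<^sub>1 \<longleftrightarrow> i < card V\<^sub>1" if "i < n" for i
  proof (cases "i < card V\<^sub>1")
    case True
    then show ?thesis using vs len1 by (auto simp: nth_append enumerates_def)
  next
    case False
    then have "vs ! i \<in> set vs\<^sub>2" using that vs(3) len1 len2 n12 by (auto simp: nth_append)
    then show ?thesis using False vs(2) bip by (auto simp: enumerates_def)
  qed
  have jz: "?j = ?z @\<^sub>v 0\<^sub>v m"
    by (rule eq_vecI) (auto simp: n12 mem)
  have "transpose_mat R *\<^sub>v ?z = 0\<^sub>v m"
    using transpose_incidence_mult_vec[OF ev G(1) es V] len R by simp
  moreover have "?z \<noteq> 0\<^sub>v n"
  proof
    assume "?z = 0\<^sub>v n"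
    from arg_cong[OF this, of "\<lambda>w. w $ 0"] show False using n0 by (auto split: if_splits)
  qed
  ultimately have "eigenvector Q\<^sub>Q ?j (real r)"
    unfolding QQ jz by (intro eigenvector_Q_block_cokernel[OF Rc]) auto
  then have J: "eigenvector Q\<^sub>Q ((1 / sqrt (real n)) \<cdot>\<^sub>v ?j) (real r)"
    by (rule eigenvector_smult[OF QQc]) (use n0 in simp)
  then have J0: "eigenvalue Q\<^sub>Q (real r)" unfolding eigenvalue_def by blast

  have X: "let \<theta> = (3 * real r + q i - 2 + s * sqrt ((q i + real r - 2)\<^sup>2 + 4 * q i)) / 2;
            c = \<theta> + 2 - 2 * real r - q i
        in eigenvalue Q\<^sub>Q \<theta> \<and>
           (\<forall>j\<in>{1..l i}.
              eigenvector Q\<^sub>Q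
                ((1 / sqrt (c\<^sup>2 + q i)) \<cdot>\<^sub>v (c \<cdot>\<^sub>v x i j @\<^sub>v (transpose_mat R *\<^sub>v x i j))) \<theta>)"
    if i: "i < d" and s: "s \<in> {1, - 1}" for i s
  proof -
    define S where "S = sqrt ((q i + real r - 2)\<^sup>2 + 4 * q i)"
    define \<theta> where "\<theta> = (3 * real r + q i - 2 + s * S) / 2"
    define c where "c = \<theta> + 2 - 2 * real r - q i"
    \<comment> \<open>Strict decrease down to q d = 0 gives positivity for i < d. It makes the
      radicand nonnegative, permits the lift, and keeps the normalising factor finite and
      nonzero.\<close>
    have qi: "q i > 0" using q(3)[OF i] q(2) by simp
    have "(s * S)\<^sup>2 = S\<^sup>2" using s by (auto simp: power_mult_distrib)
    also have "S\<^sup>2 = (q i + real r - 2)\<^sup>2 + 4 * q i"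
      unfolding S_def using qi by (intro real_sqrt_pow2) auto
    finally have sS: "(s * S)\<^sup>2 = (q i + real r - 2)\<^sup>2 + 4 * q i" .
    \<comment> \<open>In this form c (\<theta> - r) is a difference of squares, and the choice of
      \<open>S\<close> leaves exactly q i.\<close>
    have c2: "c = (s * S - (q i + real r - 2)) / 2" and t2: "\<theta> - r = (s * S + (q i + real r - 2)) / 2"
      by (auto simp: c_def \<theta>_def field_simps)
    have "c * (\<theta> - r) = ((s * S)\<^sup>2 - (q i + real r - 2)\<^sup>2) / 4"
      unfolding c2 t2 by (simp add: power2_eq_square algebra_simps)
    then have cq: "c * (\<theta> - r) = q i" using sS by simp
    have lift: "eigenvector Q\<^sub>Q (c \<cdot>\<^sub>v v @\<^sub>v (transpose_mat R *\<^sub>v v)) \<theta>"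
      if "eigenvector Q\<^sub>G v (q i)" for v
      unfolding QQ using eigenvector_Q_block_lift[OF Rc _ _ c_def cq] that qi QG by simp
    \<comment> \<open>The spectrum hypothesis supplies some eigenvector to lift, so \<theta> is an
      eigenvalue without first showing that \<open>l i\<close> is positive.\<close>
    have "eigenvalue Q\<^sub>G (q i)" using q(4) i by auto
    then have "eigenvalue Q\<^sub>Q \<theta>" using lift unfolding eigenvalue_def by blast
    moreover have "c\<^sup>2 + q i > 0" using qi by (simp add: add_nonneg_pos)
    then have "1 / sqrt (c\<^sup>2 + q i) \<noteq> 0" by simp
    then have "\<forall>j\<in>{1..l i}. eigenvector Q\<^sub>Q
        ((1 / sqrt (c\<^sup>2 + q i)) \<cdot>\<^sub>v (c \<cdot>\<^sub>v x i j @\<^sub>v (transpose_mat R *\<^sub>v x i j))) \<theta>"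
      using eigenvector_smult[OF QQc lift] x(2)[of i] i by auto
    ultimately show ?thesis unfolding Let_def c_def \<theta>_def S_def by blast
  qed
  show ?thesis using Y Y0 J J0 X by blast
qed

end
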